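(* For every integer $n\ge 3$, the pair $(\widehat{\mathrm{cDes}},\hat\rho)$, with $\widehat{\mathrm{cDes}}$ and $\hat\rho$ as defined in the context, is a cyclic extension of $\widehat{\mathrm{Des}}$ on $\mathbf M_n^*$.
   Context: Write $[n]=\{1,\dots,n\}$ and let $2^{X}$ denote the power set of $X$. Cyclic extension. Let $\mathcal F$ be a finite set with a map $\mathrm{Des}:\mathcal F\to 2^{[n-1]}$. A cyclic extension of $\mathrm{Des}$ is a pair $(\mathrm{cDes},p)$, where $\mathrm{cDes}:\mathcal F\to 2^{[n]}$ is a map and $p:\mathcal F\to\mathcal F$ is a bijection, such that for all $F\in\mathcal F$: (extension) $\mathrm{cDes}(F)\cap[n-1]=\mathrm{Des}(F)$; (equivariance) $\mathrm{cDes}(p(F))=\mathrm{cDes}(F)+1$, where $1$ is added to every element modulo $n$ (so $n$ becomes $1$); (non-Escher) $\varnothing\subsetneq \mathrm{cDes}(F)\subsetneq[n]$. Motzkin paths. A Motzkin path of length $n$ is a lattice path from $(0,0)$ to $(n,0)$ with steps $U=(1,1)$, $D=(1,-1)$, $L=(1,0)$ that never passes below the $x$-axis; it is identified with its word of steps. $\mathbf M_n$ is the set of Motzkin paths of length $n$, $L^n$ is the path all of whose steps are $L$, and $\mathbf M_n^*=\mathbf M_n\setminus\{L^n\}$. A return is a $D$ step ending on the $x$-axis; a start is a $U$ step starting on the $x$-axis. Descents (order $U>L>D$). $\widehat{\mathrm{Des}}(M)\subseteq[n-1]$ is the set of $i$ such that the $i$th and $(i+1)$st steps of $M$ are $UD$,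 $UL$ or $LD$ (in this order). Cyclic descents. For $M\in\mathbf M_n^*$, $\widehat{\mathrm{cDes}}(M)\cap[n-1]=\widehat{\mathrm{Des}}(M)$, and $n\in\widehat{\mathrm{cDes}}(M)$ if and only if one of the following holds: (1) the first step of $M$ is $L$ and the step immediately preceding the rightmost return of $M$ is not $L$; (2) the first step of $M$ is $U$, $M$ has only one return, and the step immediately preceding this return is not $L$. The map $\hat\rho$. For $M\in\mathbf M_n^*$, $\hat\rho M$ is defined according to the step immediately before the last return of $M$. Case 1: this step is $U$. Write $M=P\,L^i\,U\,D\,L^j$ with $i,j\ge 0$, where $P$ is a Motzkin path that is empty or has final step $D$. If $j=0$, set $\hat\rho M=U\,P\,D\,L^i$. If $j\ge1$, set $\hat\rho M=U\,P\,L^{i+1}\,D\,L^{j-1}$. Case 2: this step is $L$. Write $M=P\,L^i\,D\,L^j$ with $i\ge1$, $j\ge 0$, where $P$ is an initial segment of $M$ whose final step is not $L$. If $j=0$, set $\hat\rho M=L\,P\,D\,L^{i-1}$. If $j\ge1$, set $\hat\rho M=L\,P\,L^{i}\,D\,L^{j-1}$. Case 3: this step is $D$. Write $M=P\,L^i\,U\,L^k\,P'\,D\,L^j$ with $i,j,k\ge0$, where the displayed $U$ is the last start step of $M$, $P$ is a Motzkin path that is empty or has final step $D$, and $P'$ is a Motzkin path whose first step is $U$ and whose final step is $D$. If $k=0$, set $\hat\rho M=U\,P\,D\,L^i\,P'\,L^j$. If $k\ge1$, set $\hat\rho M=U\,P\,L^{i+1}\,D\,L^{k-1}\,P'\,L^j$.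 *)

theory Defs
  imports Main
begin

definition cyclic_extension ::
  "nat \<Rightarrow> 'a set \<Rightarrow> ('a \<Rightarrow> nat set) \<Rightarrow> ('a \<Rightarrow> nat set) \<Rightarrow> ('a \<Rightarrow> 'a) \<Rightarrow> bool"
where
  "cyclic_extension n F Des cDes p \<longleftrightarrow>
     finite F \<and>
     (\<forall>x\<in>F. Des x \<subseteq> {1..n-1}) \<and>
     (\<forall>x\<in>F. cDes x \<subseteq> {1..n}) \<and>
     bij_betw p F F \<and>
     (\<forall>x\<in>F. cDes x \<inter> {1..n-1} = Des x) \<and>
     \<comment> \<open>adding 1 modulo \<open>n\<close> with representatives \<open>1, \<dots>, n\<close>: \<open>i\<close> becomes \<open>i + 1\<close> for \<open>i < n\<close>, and \<open>n\<close> becomes \<open>1\<close>\<close>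
     (\<forall>x\<in>F. cDes (p x) = (\<lambda>i. i mod n + 1) ` cDes x) \<and>
     (\<forall>x\<in>F. {} \<subset> cDes x \<and> cDes x \<subset> {1..n})"

datatype step = U | L | D

fun rise :: "step \<Rightarrow> int" where
  "rise U = 1"
| "rise L = 0"
| "rise D = -1"

text \<open>The \<open>y\<close>-coordinate of the end point of a word of steps, read as a lattice path from the
  origin. The \<open>x\<close>-coordinate is the length of the word.\<close>

definition height :: "step list \<Rightarrow> int" where
  "height w = (\<Sum>s\<leftarrow>w. rise s)"

definition motzkin_path :: "step list \<Rightarrow> bool" where
  "motzkin_path w \<longleftrightarrow> height w = 0 \<and> (\<forall>k\<le>length w. height (take k w) \<ge> 0)"

definition Motzkin :: "nat \<Rightarrow> step list set" where
  "Motzkin n = {w. length w = n \<and> motzkin_path w}"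

definition Motzkin_star :: "nat \<Rightarrow> step list set" where
  "Motzkin_star n = Motzkin n - {replicate n L}"

text \<open>Positions of steps are counted from 1, so the \<open>i\<close>th step of \<open>M\<close> is \<open>M ! (i - 1)\<close>.\<close>

definition returns :: "step list \<Rightarrow> nat set" where
  "returns M = {i \<in> {1..length M}. M ! (i - 1) = D \<and> height (take i M) = 0}"

definition starts :: "step list \<Rightarrow> nat set" where
  "starts M = {i \<in> {1..length M}. M ! (i - 1) = U \<and> height (take (i - 1) M) = 0}"

definition last_return :: "step list \<Rightarrow> nat" where
  "last_return M = Max (returns M)"

definition last_start :: "step list \<Rightarrow> nat" where
  "last_start M = Max (starts M)"

text \<open>On \<open>Motzkin_star n\<close> there is a return, and the last return is never the first step.\<close>

definition step_before_last_return :: "step list \<Rightarrow> step" where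
  "step_before_last_return M = M ! (last_return M - 1 - 1)"

text \<open>These are the descents of the word for the order \<open>U > L > D\<close>.\<close>

definition Des_hat :: "step list \<Rightarrow> nat set" where
  "Des_hat M = {i \<in> {1..length M - 1}. (M ! (i - 1), M ! i) \<in> {(U, D), (U, L), (L, D)}}"

definition cDes_hat :: "step list \<Rightarrow> nat set" where
  "cDes_hat M = Des_hat M \<union>
     (if (hd M = L \<and> step_before_last_return M \<noteq> L) \<or>
         (hd M = U \<and> card (returns M) = 1 \<and> step_before_last_return M \<noteq> L)
      then {length M} else {})"

definition motzkin_empty_or_final_D :: "step list \<Rightarrow> bool" where
  "motzkin_empty_or_final_D P \<longleftrightarrow> motzkin_path P \<and> (P = [] \<or> last P = D)"

abbreviation Ls :: "nat \<Rightarrow> step list" where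
  "Ls i \<equiv> replicate i L"

text \<open>\<open>rho_rel M N\<close>: the case analysis defining the map yields \<open>N\<close> from \<open>M\<close> for some
  factorization of \<open>M\<close> of the prescribed form.\<close>

inductive rho_rel :: "step list \<Rightarrow> step list \<Rightarrow> bool" where
  case1_zero:
    "step_before_last_return M = U \<Longrightarrow>
     M = P @ Ls i @ [U, D] \<Longrightarrow> motzkin_empty_or_final_D P \<Longrightarrow>
     rho_rel M ([U] @ P @ [D] @ Ls i)"
| case1_pos:
    "step_before_last_return M = U \<Longrightarrow>
     M = P @ Ls i @ [U, D] @ Ls j \<Longrightarrow> motzkin_empty_or_final_D P \<Longrightarrow> j \<ge> 1 \<Longrightarrow>
     rho_rel M ([U] @ P @ Ls (i + 1) @ [D] @ Ls (j - 1))"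
| case2_zero:
    "step_before_last_return M = L \<Longrightarrow>
     M = P @ Ls i @ [D] \<Longrightarrow> P \<noteq> [] \<Longrightarrow> last P \<noteq> L \<Longrightarrow> i \<ge> 1 \<Longrightarrow>
     rho_rel M ([L] @ P @ [D] @ Ls (i - 1))"
| case2_pos:
    "step_before_last_return M = L \<Longrightarrow>
     M = P @ Ls i @ [D] @ Ls j \<Longrightarrow> P \<noteq> [] \<Longrightarrow> last P \<noteq> L \<Longrightarrow> i \<ge> 1 \<Longrightarrow> j \<ge> 1 \<Longrightarrow>
     rho_rel M ([L] @ P @ Ls i @ [D] @ Ls (j - 1))"
| case3_zero:
    "step_before_last_return M = D \<Longrightarrow>
     M = P @ Ls i @ [U] @ P' @ [D] @ Ls j \<Longrightarrow>
     last_start M = length P + i + 1 \<Longrightarrow> motzkin_empty_or_final_D P \<Longrightarrow>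
     motzkin_path P' \<Longrightarrow> P' \<noteq> [] \<Longrightarrow> hd P' = U \<Longrightarrow> last P' = D \<Longrightarrow>
     rho_rel M ([U] @ P @ [D] @ Ls i @ P' @ Ls j)"
| case3_pos:
    "step_before_last_return M = D \<Longrightarrow>
     M = P @ Ls i @ [U] @ Ls k @ P' @ [D] @ Ls j \<Longrightarrow>
     last_start M = length P + i + 1 \<Longrightarrow> motzkin_empty_or_final_D P \<Longrightarrow>
     motzkin_path P' \<Longrightarrow> P' \<noteq> [] \<Longrightarrow> hd P' = U \<Longrightarrow> last P' = D \<Longrightarrow> k \<ge> 1 \<Longrightarrow>
     rho_rel M ([U] @ P @ Ls (i + 1) @ [D] @ Ls (k - 1) @ P' @ Ls j)"

text \<open>Each \<open>M\<close> in \<open>Motzkin_star n\<close> is \<open>rho_rel\<close>-related to exactly one word. Where this fails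
  (for instance on \<open>replicate n L\<close>) the value is unspecified.\<close>

definition rho_hat :: "step list \<Rightarrow> step list" where
  "rho_hat M = (THE N. rho_rel M N)"

end

theory Submission
  imports Defs
begin

text \<open>Equivariance: in every case \<open>rho_hat\<close> moves the descents of the blocks one position to
  the right, so it suffices to follow what happens at the junctions between blocks.
  Bijectivity: the output of \<open>rho_hat\<close> is decoded by its first step and, if this is \<open>U\<close>, by its
  first return: a first step \<open>L\<close> betrays case 2, and otherwise the part after the first return
  is flat precisely in case 1. The step before the last (case 2) or first (cases 1 and 3) return
  tells whether the exponent on which the case splits was zero. So \<open>rho_hat\<close> is an injective
  self-map of a finite set.\<close>

section \<open>Lattice paths\<close>

text \<open>The starting height is a parameter so that nonnegativity can be computed step by step
  and across concatenation; \<open>motzkin_path\<close> alone has no such recursion.\<close>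

definition nonneg_from :: "int \<Rightarrow> step list \<Rightarrow> bool" where
  "nonneg_from h w \<longleftrightarrow> (\<forall>k\<le>length w. 0 \<le> h + height (take k w))"

lemma height_simps [simp]:
  "height [] = 0" "height (s # w) = rise s + height w"
  "height (u @ v) = height u + height v" "height (Ls i) = 0"
  by (simp_all add: height_def sum_list_replicate)

lemma nonneg_from_Nil [simp]: "nonneg_from h [] \<longleftrightarrow> 0 \<le> h"
  by (simp add: nonneg_from_def)

lemma nonneg_from_Cons [simp]:
  "nonneg_from h (s # w) \<longleftrightarrow> 0 \<le> h \<and> nonneg_from (h + rise s) w"
proof -
  have "(\<forall>k\<le>Suc (length w). P k) \<longleftrightarrow> P 0 \<and> (\<forall>k\<le>length w. P (Suc k))" for P
    by (metis Suc_le_mono le0 not0_implies_Suc)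
  then show ?thesis
    by (simp add: nonneg_from_def add.assoc)
qed

lemma nonneg_from_start: "nonneg_from h w \<Longrightarrow> 0 \<le> h"
  by (cases w) auto

lemma not_nonneg_from_neg [simp]: "h < 0 \<Longrightarrow> \<not> nonneg_from h w"
  using nonneg_from_start by fastforce

lemma nonneg_from_end: "nonneg_from h w \<Longrightarrow> 0 \<le> h + height w"
proof (induction w arbitrary: h)
  case (Cons s w)
  then show ?case using Cons.IH[of "h + rise s"] by (simp add: add.assoc)
qed simp

lemma nonneg_from_append [simp]:
  "nonneg_from h (u @ v) \<longleftrightarrow> nonneg_from h u \<and> nonneg_from (h + height u) v"
  by (induction u arbitrary: h) (auto simp: add.assoc dest: nonneg_from_start)

lemma nonneg_from_Ls [simp]: "nonneg_from h (Ls i) \<longleftrightarrow> 0 \<le> h"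
  by (induction i) auto

lemma nonneg_from_mono: "nonneg_from h w \<Longrightarrow> h \<le> h' \<Longrightarrow> nonneg_from h' w"
  by (force simp: nonneg_from_def)

lemma motzkin_path_iff: "motzkin_path w \<longleftrightarrow> height w = 0 \<and> nonneg_from 0 w"
  by (simp add: motzkin_path_def nonneg_from_def)

lemma motzkin_path_height: "motzkin_path w \<Longrightarrow> height w = 0"
  by (simp add: motzkin_path_iff)

lemma motzkin_path_cancel: "motzkin_path u \<Longrightarrow> motzkin_path (u @ v) \<longleftrightarrow> motzkin_path v"
  by (auto simp: motzkin_path_iff)

lemma motzkin_path_cancel_right:
  "motzkin_path v \<Longrightarrow> motzkin_path (u @ v) \<longleftrightarrow> motzkin_path u"
  by (auto simp: motzkin_path_iff)

lemma motzkin_path_Ls [simp]: "motzkin_path (Ls i)"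
  by (simp add: motzkin_path_iff)

lemma motzkin_path_L_Cons [simp]: "motzkin_path (L # w) \<longleftrightarrow> motzkin_path w"
  by (auto simp: motzkin_path_iff)

lemma motzkin_path_Nil [simp]: "motzkin_path []"
  by (simp add: motzkin_path_iff)

lemma motzkin_path_lift: "motzkin_path Q \<Longrightarrow> motzkin_path (U # Q @ [D])"
  by (auto simp: motzkin_path_iff intro: nonneg_from_mono)

text \<open>A first step \<open>D\<close> would leave the half-plane. The conclusion is emptiness
  because \<open>hd []\<close> is unspecified and might be \<open>D\<close>.\<close>

lemma motzkin_path_hd: "motzkin_path w \<Longrightarrow> hd w = D \<Longrightarrow> w = []"
  by (cases w) (auto simp: motzkin_path_iff dest: nonneg_from_start)

lemma height_nonneg_if_no_D: "D \<notin> set w \<Longrightarrow> 0 \<le> height w"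
proof (induction w)
  case (Cons s w)
  then show ?case by (cases s) auto
qed simp

lemma flat_if_no_D: "D \<notin> set w \<Longrightarrow> height w \<le> 0 \<Longrightarrow> w = Ls (length w)"
proof (induction w)
  case (Cons s w)
  then show ?case using height_nonneg_if_no_D[of w] by (cases s) auto
qed simp

text \<open>The last \<open>D\<close> ends at height at least 0, and what follows has no
  \<open>D\<close>, so it cannot descend; as the path ends at 0, both contributions vanish. Hence
  the last \<open>D\<close> is the last return and only level steps follow it.\<close>

lemma motzkin_path_last_D:
  assumes "motzkin_path M" "D \<in> set M"
  obtains A j where "M = A @ D # Ls j" "height A = 1" "nonneg_from 0 A"
proof -
  obtain A B where M: "M = A @ D # B" "D \<notin> set B"
    using assms(2) split_list_last by metis
  have h: "height A - 1 + height B = 0" "nonneg_from 0 A" "nonneg_from (height A - 1) B"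
    using assms(1) by (auto simp: M motzkin_path_iff)
  then have "height B \<le> 0"
    using nonneg_from_start by fastforce
  then have "B = Ls (length B)"
    using M(2) flat_if_no_D by blast
  then have "height A = 1"
    using h(1) by (metis height_simps(4) add.right_neutral eq_iff_diff_eq_0)
  with that M(1) \<open>B = _\<close> h(2) show thesis by metis
qed

text \<open>If one of the two paths were longer, it would contain the other followed by
  \<open>D\<close>, hence reach height -1. After a leading \<open>U\<close>, this makes the cut at
  the first return unique.\<close>

lemma first_return_unique:
  assumes "Q @ D # T = Q' @ D # T'" "motzkin_path Q" "motzkin_path Q'"
  shows "Q = Q' \<and> T = T'"
proof -
  have *: False if "Q @ D # v = Q'" "motzkin_path Q" "motzkin_path Q'" for Q v Q'
    using that by (auto simp: motzkin_path_iff dest: nonneg_from_start)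
  from assms(1) obtain us where
    "Q = Q' @ us \<and> us @ D # T = D # T' \<or> Q @ us = Q' \<and> D # T = us @ D # T'"
    by (auto simp: append_eq_append_conv2)
  then show ?thesis
    using assms(2,3) * by (cases us) auto
qed

text \<open>Induction from the right: if the shorter word already ends above the axis, its last
  departure survives, since the longer word still ends at height at least 1; otherwise the new step
  is itself the departure.\<close>

lemma last_ascent_from_axis:
  assumes "nonneg_from 0 A" "1 \<le> height A"
  obtains X Y where "A = X @ U # Y" "motzkin_path X" "nonneg_from 0 Y"
proof -
  have "\<exists>X Y. A = X @ U # Y \<and> motzkin_path X \<and> nonneg_from 0 Y"
    using assms
  proof (induction A rule: rev_induct)
    case (snoc s B)
    show ?case
    proof (cases "1 \<le> height B")
      case True
      then obtain X Y where XY: "B = X @ U # Y" "motzkin_path X" "nonneg_from 0 Y"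
        using snoc by auto
      then have "B @ [s] = X @ U # (Y @ [s])" "nonneg_from 0 (Y @ [s])"
        using snoc.prems nonneg_from_end[OF XY(3)] by (auto simp: motzkin_path_height)
      then show ?thesis using XY(2) by blast
    next
      case False
      then have "height B = 0" "s = U"
        using snoc.prems nonneg_from_end[of 0 B] by (cases s; auto)+
      then have "B @ [s] = B @ U # []" "motzkin_path B"
        using snoc.prems by (auto simp: motzkin_path_iff)
      then show ?thesis by fastforce
    qed
  qed simp
  with that show thesis by blast
qed

section \<open>Returns and starts\<close>

lemma finite_returns [simp]: "finite (returns M)"
  by (simp add: returns_def)

lemma mem_returns_append_D: "A @ D # B = M \<Longrightarrow> height A = 1 \<Longrightarrow> Suc (length A) \<in> returns M"
  by (auto simp: returns_def nth_append)

lemma returns_split: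
  assumes "r \<in> returns M"
  obtains A B where "M = A @ D # B" "length A = r - 1" "height A = 1" "1 \<le> r"
proof -
  have r: "r - 1 < length M" "M ! (r - 1) = D" "height (take r M) = 0" "1 \<le> r"
    using assms by (auto simp: returns_def)
  have M: "M = take (r - 1) M @ D # drop r M"
    using id_take_nth_drop[OF r(1)] r by auto
  have "take r M = take (r - 1) M @ [D]"
    using take_Suc_conv_app_nth[OF r(1)] r by auto
  with r(3) have "height (take (r - 1) M) = 1" by simp
  with that M r show thesis by simp
qed

lemma returns_eq_empty_iff:
  assumes "motzkin_path M"
  shows "returns M = {} \<longleftrightarrow> D \<notin> set M"
proof (cases "D \<in> set M")
  case True
  then obtain A j where "M = A @ D # Ls j" "height A = 1"
    using motzkin_path_last_D[OF assms] by metis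
  then have "Suc (length A) \<in> returns M"
    by (simp add: mem_returns_append_D)
  with True show ?thesis by auto
next
  case False
  have "r \<notin> returns M" for r
  proof
    assume "r \<in> returns M"
    then obtain A B where "M = A @ D # B" by (rule returns_split)
    with False show False by simp
  qed
  with False show ?thesis by auto
qed

lemma returns_append:
  assumes "motzkin_path P"
  shows "returns (P @ X) = returns P \<union> (\<lambda>i. i + length P) ` returns X"
proof (intro set_eqI iffI)
  fix r assume r: "r \<in> returns (P @ X)"
  show "r \<in> returns P \<union> (\<lambda>i. i + length P) ` returns X"
  proof (cases "r \<le> length P")
    case True
    then show ?thesis using r by (auto simp: returns_def nth_append split: if_splits)
  next
    case False
    then obtain m where m: "r = Suc (length P) + m"
      by (metis le_Suc_ex not_less_eq_eq)
    with r have "Suc m \<in> returns X"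
      using motzkin_path_height[OF assms] by (auto simp: returns_def nth_append)
    then have "Suc m + length P \<in> (\<lambda>i. i + length P) ` returns X" by blast
    then show ?thesis by (simp add: m add.commute)
  qed
next
  fix r assume "r \<in> returns P \<union> (\<lambda>i. i + length P) ` returns X"
  then show "r \<in> returns (P @ X)"
    using motzkin_path_height[OF assms] by (auto simp: returns_def nth_append)
qed

lemma card_returns_append:
  assumes "motzkin_path P"
  shows "card (returns (P @ X)) = card (returns P) + card (returns X)"
proof -
  have "returns P \<inter> (\<lambda>i. i + length P) ` returns X = {}"
    by (auto simp: returns_def)
  moreover have "card ((\<lambda>i. i + length P) ` returns X) = card (returns X)"
    by (simp add: card_image)
  ultimately show ?thesis
    by (simp add: returns_append[OF assms] card_Un_disjoint)
qed

text \<open>The leading \<open>U\<close> keeps the height at least 1 throughout \<open>Q\<close>, so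
  only the closing \<open>D\<close> can meet the axis.\<close>

lemma returns_lift:
  assumes "motzkin_path Q"
  shows "returns (U # Q @ [D]) = {length Q + 2}"
proof (intro set_eqI iffI)
  fix r assume "r \<in> returns (U # Q @ [D])"
  then obtain A B where AB: "U # Q @ [D] = A @ D # B" "length A = r - 1" "height A = 1" "1 \<le> r"
    by (rule returns_split)
  then obtain A' where A': "A = U # A'" "Q @ [D] = A' @ D # B" "height A' = 0"
    by (cases A) auto
  have "B = []"
  proof (rule ccontr)
    assume "B \<noteq> []"
    then obtain B' b where "B = B' @ [b]" using rev_exhaust by blast
    with A' have "Q = A' @ D # B'" by simp
    with A'(3) assms show False
      by (auto simp: motzkin_path_iff dest: nonneg_from_start)
  qed
  with AB(2,4) A' show "r \<in> {length Q + 2}" by auto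
next
  fix r assume "r \<in> {length Q + 2}"
  then show "r \<in> returns (U # Q @ [D])"
    using mem_returns_append_D[of "U # Q" "[]" "U # Q @ [D]"] motzkin_path_height[OF assms]
    by simp
qed

lemma last_return_eq:
  assumes "height A = 1"
  shows "last_return (A @ D # Ls j) = Suc (length A)"
  unfolding last_return_def
proof (rule Max_eqI)
  fix r assume r: "r \<in> returns (A @ D # Ls j)"
  show "r \<le> Suc (length A)"
  proof (rule ccontr)
    assume "\<not> r \<le> Suc (length A)"
    then obtain m where m: "r = Suc (Suc (length A)) + m"
      by (metis le_Suc_ex not_less_eq_eq)
    with r have "m < j" by (simp add: returns_def)
    with r show False by (auto simp: returns_def m nth_append)
  qed
qed (use assms mem_returns_append_D in auto)

lemma step_before_last_return_eq:
  assumes "height A = 1"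
  shows "step_before_last_return (A @ D # Ls j) = last A"
proof -
  have "A \<noteq> []" using assms by auto
  then show ?thesis
    by (auto simp: step_before_last_return_def last_return_eq[OF assms] nth_append last_conv_nth)
qed

lemma last_start_eq:
  assumes "motzkin_path X" "motzkin_path Y"
  shows "last_start (X @ U # Y @ D # Ls j) = Suc (length X)"
  unfolding last_start_def
proof (rule Max_eqI)
  let ?M = "X @ U # Y @ D # Ls j"
  show "finite (starts ?M)" by (simp add: starts_def)
  show "Suc (length X) \<in> starts ?M"
    using assms(1) by (auto simp: starts_def motzkin_path_height)
  fix r assume r: "r \<in> starts ?M"
  show "r \<le> Suc (length X)"
  proof (rule ccontr)
    assume "\<not> r \<le> Suc (length X)"
    then obtain k where k: "r = Suc (Suc (length X)) + k"
      by (metis le_Suc_ex not_less_eq_eq)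
    \<comment> \<open>Heights are now relative to level 1, so a start on the axis has relative
      height -1. Being a \<open>U\<close>, the step lies in \<open>Y\<close>, which never gets that
      low.\<close>
    have "(Y @ D # Ls j) ! k = U" "height (take k (Y @ D # Ls j)) = -1" "k < length Y + Suc j"
      using r assms(1) by (auto simp: starts_def k nth_append motzkin_path_height)
    moreover from this have "k < length Y"
      by (auto simp: nth_append nth_Cons' split: if_splits)
    moreover from this have "0 \<le> height (take k Y)"
      using assms(2) by (simp add: motzkin_path_def)
    ultimately show False by simp
  qed
qed

section \<open>Factorizations\<close>

text \<open>A trailing run of \<open>L\<close> is maximal once the word before it does not end in
  \<open>L\<close>; stripping it recovers that word. This and its mirror image determine the
  exponents in all factorizations.\<close>

lemma append_Ls_cancel:
  assumes "xs @ Ls i = ys @ Ls j" "xs = [] \<or> last xs \<noteq> L" "ys = [] \<or> last ys \<noteq> L"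
  shows "xs = ys \<and> i = j"
proof -
  have "dropWhile (\<lambda>s. s = L) (rev (xs @ Ls i)) = rev xs" if "xs = [] \<or> last xs \<noteq> L" for xs i
    using that by (cases xs rule: rev_cases) (auto simp: dropWhile_append)
  from this[OF assms(2), of i] this[OF assms(3), of j] assms(1) have "xs = ys" by simp
  with assms(1) show ?thesis by simp
qed

lemma Ls_append_cancel:
  assumes "Ls i @ xs = Ls j @ ys" "xs = [] \<or> hd xs \<noteq> L" "ys = [] \<or> hd ys \<noteq> L"
  shows "xs = ys \<and> i = j"
proof -
  have "rev xs @ Ls i = rev ys @ Ls j"
    using arg_cong[OF assms(1), of rev] by simp
  from append_Ls_cancel[OF this] assms(2,3) show ?thesis
    by (auto simp: last_rev)
qed

lemma strip_Ls_right:
  obtains xs i where "w = xs @ Ls i" "xs = [] \<or> last xs \<noteq> L"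
proof -
  have "\<exists>xs i. w = xs @ Ls i \<and> (xs = [] \<or> last xs \<noteq> L)"
  proof (induction w rule: rev_induct)
    case (snoc s w)
    then obtain xs i where w: "w = xs @ Ls i" "xs = [] \<or> last xs \<noteq> L" by blast
    show ?case
    proof (cases "s = L")
      case True
      then have "w @ [s] = xs @ Ls (Suc i)" using w by (simp add: replicate_append_same)
      with w(2) show ?thesis by blast
    next
      case False
      then have "w @ [s] = (w @ [s]) @ Ls 0" "last (w @ [s]) \<noteq> L" by simp_all
      then show ?thesis by blast
    qed
  qed (metis append_Nil replicate_0)
  with that show thesis by blast
qed

lemma strip_Ls_left:
  obtains xs i where "w = Ls i @ xs" "xs = [] \<or> hd xs \<noteq> L"
proof -
  obtain xs i where "rev w = xs @ Ls i" "xs = [] \<or> last xs \<noteq> L"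
    by (rule strip_Ls_right)
  then have "w = Ls i @ rev xs" "rev xs = [] \<or> hd (rev xs) \<noteq> L"
    by (metis rev_append rev_replicate rev_rev_ident, auto simp: hd_rev)
  with that show thesis by blast
qed

text \<open>Once trailing \<open>L\<close> steps are stripped, the last step cannot be
  \<open>U\<close>, since the path would have been below the axis just before it. So it is
  \<open>D\<close>.\<close>

lemma motzkin_path_strip:
  assumes "motzkin_path X"
  obtains P i where "X = P @ Ls i" "motzkin_empty_or_final_D P"
proof -
  obtain P i where P: "X = P @ Ls i" "P = [] \<or> last P \<noteq> L" by (rule strip_Ls_right)
  have m: "motzkin_path P" using assms by (simp add: P(1) motzkin_path_cancel_right)
  have "last P \<noteq> U" if ne: "P \<noteq> []"
  proof
    assume "last P = U"
    then obtain B where "P = B @ [U]" using ne by (cases P rule: rev_cases) auto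
    with m show False using nonneg_from_end[of 0 B] by (auto simp: motzkin_path_iff)
  qed
  then have "P = [] \<or> last P = D"
    using P(2) by (cases "last P") auto
  with P(1) m that show thesis by (simp add: motzkin_empty_or_final_D_def)
qed

section \<open>The case analysis defines a total function\<close>

lemma rho_rel_cases [consumes 1, case_names 1 2 3]:
  assumes "rho_rel M N"
  obtains
    P i j where "step_before_last_return M = U" "M = P @ Ls i @ U # D # Ls j"
      "motzkin_empty_or_final_D P"
      "N = (if j = 0 then U # P @ D # Ls i else U # P @ Ls (Suc i) @ D # Ls (j - 1))"
  | P i j where "step_before_last_return M = L" "M = P @ Ls i @ D # Ls j" "P \<noteq> []" "last P \<noteq> L"
      "1 \<le> i" "N = (if j = 0 then L # P @ D # Ls (i - 1) else L # P @ Ls i @ D # Ls (j - 1))"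
  | P i k P' j where "step_before_last_return M = D" "M = P @ Ls i @ U # Ls k @ P' @ D # Ls j"
      "last_start M = length P + i + 1" "motzkin_empty_or_final_D P"
      "motzkin_path P'" "P' \<noteq> []" "hd P' = U" "last P' = D"
      "N = (if k = 0 then U # P @ D # Ls i @ P' @ Ls j
            else U # P @ Ls (Suc i) @ D # Ls (k - 1) @ P' @ Ls j)"
  using assms
proof cases
  case (case1_zero P i)
  then show ?thesis by (intro that(1)[of P i 0]) auto
next
  case (case1_pos P i j)
  then show ?thesis by (intro that(1)[of P i j]) auto
next
  case (case2_zero P i)
  then show ?thesis by (intro that(2)[of P i 0]) auto
next
  case (case2_pos P i j)
  then show ?thesis by (intro that(2)[of P i j]) auto
next
  case (case3_zero P i P' j)
  then show ?thesis by (intro that(3)[of P i 0 P' j]) auto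
next
  case (case3_pos P i k P' j)
  then show ?thesis by (intro that(3)[of P i k P' j]) auto
qed

text \<open>The step before the last return separates the three cases. Within a case, the runs of
  \<open>L\<close> fix the blocks; in case 3 the position of the last start first fixes where the
  word is cut.\<close>

lemma rho_rel_functional:
  assumes "rho_rel M N" "rho_rel M N'"
  shows "N = N'"
  using assms(1)
proof (cases rule: rho_rel_cases)
  case (1 P i j)
  note a = this
  from assms(2) show ?thesis
  proof (cases rule: rho_rel_cases)
    case (1 P' i' j')
    have "(P @ Ls i @ [U, D]) @ Ls j = (P' @ Ls i' @ [U, D]) @ Ls j'"
      using a 1 by simp
    from append_Ls_cancel[OF this] have "P @ Ls i = P' @ Ls i' \<and> j = j'" by auto
    then show ?thesis
      using append_Ls_cancel[of P i P' i'] a 1 by (auto simp: motzkin_empty_or_final_D_def)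
  qed (use a(1) in simp_all)
next
  case (2 P i j)
  note a = this
  from assms(2) show ?thesis
  proof (cases rule: rho_rel_cases)
    case (2 P' i' j')
    have "(P @ Ls i @ [D]) @ Ls j = (P' @ Ls i' @ [D]) @ Ls j'"
      using a 2 by simp
    from append_Ls_cancel[OF this] have "P @ Ls i = P' @ Ls i' \<and> j = j'" by auto
    then show ?thesis
      using append_Ls_cancel[of P i P' i'] a 2 by auto
  qed (use a(1) in simp_all)
next
  case (3 P i k R j)
  note a = this
  from assms(2) show ?thesis
  proof (cases rule: rho_rel_cases)
    case (3 P' i' k' R' j')
    have "(P @ Ls i) @ U # Ls k @ R @ D # Ls j = (P' @ Ls i') @ U # Ls k' @ R' @ D # Ls j'"
      using a(2) 3(2) by simp
    moreover have "length (P @ Ls i) = length (P' @ Ls i')" using a 3 by simp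
    ultimately have "P @ Ls i = P' @ Ls i' \<and>
        U # Ls k @ R @ D # Ls j = U # Ls k' @ R' @ D # Ls j'"
      by (metis append_eq_append_conv)
    then have *: "P @ Ls i = P' @ Ls i'"
      "(Ls k @ R @ [D]) @ Ls j = (Ls k' @ R' @ [D]) @ Ls j'"
      by simp_all
    have "P = P' \<and> i = i'"
      using append_Ls_cancel[OF *(1)] a 3 by (auto simp: motzkin_empty_or_final_D_def)
    moreover from append_Ls_cancel[OF *(2)] have "Ls k @ R = Ls k' @ R' \<and> j = j'" by auto
    moreover from this have "R = R' \<and> k = k'"
      using Ls_append_cancel[of k R k' R'] a 3 by auto
    ultimately show ?thesis using a 3 by simp
  qed (use a(1) in simp_all)
qed

lemma rho_hat_eq: "rho_rel M N \<Longrightarrow> rho_hat M = N"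
  unfolding rho_hat_def using rho_rel_functional by blast

lemma rho_rel_total:
  assumes M: "motzkin_path M" and D: "D \<in> set M"
  obtains N where "rho_rel M N"
proof -
  obtain A j where A: "M = A @ D # Ls j" "height A = 1" "nonneg_from 0 A"
    using motzkin_path_last_D[OF assms] .
  have sb: "step_before_last_return M = last A"
    using A step_before_last_return_eq by simp
  have "A \<noteq> []" using A(2) by auto
  show thesis
  proof (cases "last A")
    case U
    then obtain X where X: "A = X @ [U]" using \<open>A \<noteq> []\<close> append_butlast_last_id by metis
    then have "motzkin_path X" using A by (auto simp: motzkin_path_iff)
    then obtain P i where P: "X = P @ Ls i" "motzkin_empty_or_final_D P"
      by (rule motzkin_path_strip)
    then show thesis
      using that case1_zero[of M P i] case1_pos[of M P i j] sb U A(1) X by (cases j) auto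
  next
    case L
    obtain W i where W: "A = W @ Ls i" "W = [] \<or> last W \<noteq> L" by (rule strip_Ls_right)
    \<comment> \<open>\<open>L\<close> steps alone cannot reach height 1.\<close>
    have "W \<noteq> []" using W A(2) by auto
    moreover from this have "1 \<le> i" using W L by (cases i) auto
    ultimately show thesis
      using that case2_zero[of M W i] case2_pos[of M W i j] sb L A(1) W by (cases j) auto
  next
    case D
    \<comment> \<open>This departure from the axis will be the last start: \<open>A\<close> has
      height 1, so \<open>Y\<close> returns to its own level and is a Motzkin path.\<close>
    obtain X Y where XY: "A = X @ U # Y" "motzkin_path X" "nonneg_from 0 Y"
      using last_ascent_from_axis[of A] A by auto
    have Y: "motzkin_path Y" using XY A(2) by (auto simp: motzkin_path_iff)
    obtain P i where P: "X = P @ Ls i" "motzkin_empty_or_final_D P"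
      using motzkin_path_strip XY(2) .
    obtain R k where R: "Y = Ls k @ R" "R = [] \<or> hd R \<noteq> L" by (rule strip_Ls_left)
    have "Y \<noteq> []" using D XY(1) by auto
    have "last Y = D" using D XY(1) \<open>Y \<noteq> []\<close> by auto
    have "R \<noteq> []" using \<open>last Y = D\<close> \<open>Y \<noteq> []\<close> R(1) by (cases k) (auto split: if_splits)
    moreover have "motzkin_path R" using Y by (simp add: R(1) motzkin_path_cancel)
    moreover have "hd R = U" using calculation R(2) motzkin_path_hd by (metis step.exhaust)
    moreover have "last R = D" using \<open>last Y = D\<close> R(1) \<open>R \<noteq> []\<close> by auto
    moreover have "last_start M = length P + i + 1"
      using last_start_eq[OF XY(2) Y, of j] by (simp add: A(1) XY(1) P(1))
    ultimately show thesis
      using that case3_zero[of M P i R j] case3_pos[of M P i k R j] sb D A(1) XY(1) P R(1)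
      by (cases k) auto
  qed
qed

section \<open>Injectivity\<close>

text \<open>Here \<open>M\<close> is written as a function of blocks that can be read off
  \<open>N\<close>. The block before the \<open>D\<close> is \<open>P\<close> alone if the exponent
  governing the case split was zero, and otherwise ends in a nonempty run of \<open>L\<close>; hence
  the tests on its last step.\<close>

lemma rho_rel_decode [consumes 1, case_names flat_start single_return several_returns]:
  assumes "rho_rel M N"
  obtains
    V a where "N = L # V @ D # Ls a" "V \<noteq> []"
      "M = (if last V = L then V @ D # Ls (Suc a) else V @ Ls (Suc a) @ [D])"
  | Q a where "N = U # Q @ D # Ls a" "motzkin_path Q"
      "M = (if Q = [] \<or> last Q \<noteq> L then Q @ Ls a @ [U, D] else butlast Q @ U # D # Ls (Suc a))"
  | Q a R j where "N = U # Q @ D # Ls a @ R @ Ls j" "motzkin_path Q" "R \<noteq> []"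
      "hd R = U" "last R = D"
      "M = (if Q = [] \<or> last Q \<noteq> L then Q @ Ls a @ U # R @ D # Ls j
            else butlast Q @ U # Ls (Suc a) @ R @ D # Ls j)"
  using assms
proof (cases rule: rho_rel_cases)
  case (1 P i j)
  then have P: "motzkin_path P" "P = [] \<or> last P = D"
    by (auto simp: motzkin_empty_or_final_D_def)
  show ?thesis
  proof (cases j)
    case 0
    then show ?thesis using 1 P by (intro that(2)[of P i]) auto
  next
    case (Suc m)
    then show ?thesis using 1 P
      \<comment> \<open>Writing the run as \<open>Ls i @ [L]\<close> exposes its last step, so that
        \<open>butlast\<close> gives back \<open>P @ Ls i\<close>.\<close>
      by (intro that(2)[of "P @ Ls (Suc i)" m])
        (auto simp: motzkin_path_cancel butlast_append simp flip: replicate_append_same)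
  qed
next
  case (2 P i j)
  then show ?thesis
  proof (cases j)
    case 0
    then show ?thesis using 2 by (intro that(1)[of P "i - 1"]) auto
  next
    case (Suc m)
    then show ?thesis using 2 by (intro that(1)[of "P @ Ls i" m]) auto
  qed
next
  case (3 P i k R j)
  then have P: "motzkin_path P" "P = [] \<or> last P = D"
    by (auto simp: motzkin_empty_or_final_D_def)
  show ?thesis
  proof (cases k)
    case 0
    then show ?thesis using 3 P by (intro that(3)[of P i R j]) auto
  next
    case (Suc m)
    then show ?thesis using 3 P
      by (intro that(3)[of "P @ Ls (Suc i)" m R j])
        (auto simp: motzkin_path_cancel butlast_append simp flip: replicate_append_same)
  qed
qed

text \<open>By the decoding it suffices that \<open>N\<close> determines its blocks: the first step,
  the first return and the runs of \<open>L\<close> do this.\<close>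

lemma rho_rel_injective:
  assumes "rho_rel M N" "rho_rel M' N"
  shows "M = M'"
  using assms(1)
proof (cases rule: rho_rel_decode)
  case (flat_start V a)
  note a = this
  from assms(2) show ?thesis
  proof (cases rule: rho_rel_decode)
    case (flat_start V' a')
    have "(V @ [D]) @ Ls a = (V' @ [D]) @ Ls a'" using a(1) flat_start(1) by simp
    from append_Ls_cancel[OF this] have "V = V' \<and> a = a'" by auto
    then show ?thesis using a(3) flat_start(3) by simp
  qed (use a(1) in simp_all)
next
  case (single_return Q a)
  note a = this
  from assms(2) show ?thesis
  proof (cases rule: rho_rel_decode)
    case (single_return Q' a')
    have "Q = Q' \<and> Ls a = Ls a'"
      using first_return_unique[of Q "Ls a" Q' "Ls a'"] a(1,2) single_return(1,2) by simp
    then show ?thesis using a(3) single_return(3) by simp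
  next
    case (several_returns Q' a' R j)
    have "Ls a = Ls a' @ R @ Ls j"
      using first_return_unique[of Q "Ls a" Q' "Ls a' @ R @ Ls j"] a(1,2) several_returns(1,2)
      by simp
    \<comment> \<open>The tail after the first return is flat in one decoding, yet contains
      \<open>R\<close>, which begins with \<open>U\<close>, in the other.\<close>
    from arg_cong[OF this, of set] have "set R \<subseteq> {L}"
      by (auto split: if_splits)
    then show ?thesis using several_returns(3,4) hd_in_set[of R] by auto
  qed (use a(1) in simp_all)
next
  case (several_returns Q a R j)
  note a = this
  from assms(2) show ?thesis
  proof (cases rule: rho_rel_decode)
    case (single_return Q' a')
    have "Ls a' = Ls a @ R @ Ls j"
      using first_return_unique[of Q' "Ls a'" Q "Ls a @ R @ Ls j"] a(1,2) single_return(1,2)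
      by simp
    from arg_cong[OF this, of set] have "set R \<subseteq> {L}"
      by (auto split: if_splits)
    then show ?thesis using a(3,4) hd_in_set[of R] by auto
  next
    case (several_returns Q' a' R' j')
    have *: "Q = Q' \<and> Ls a @ R @ Ls j = Ls a' @ R' @ Ls j'"
      using first_return_unique[of Q "Ls a @ R @ Ls j" Q' "Ls a' @ R' @ Ls j'"] a(1,2)
        several_returns(1,2) by simp
    then have "R @ Ls j = R' @ Ls j' \<and> a = a'"
      using Ls_append_cancel[of a "R @ Ls j" a' "R' @ Ls j'"] a(3,4) several_returns(3,4) by simp
    moreover from this have "R = R' \<and> j = j'"
      using append_Ls_cancel[of R j R' j'] a(5) several_returns(5) by simp
    ultimately show ?thesis using * a(6) several_returns(6) by simp
  qed (use a(1) in simp_all)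
qed

section \<open>Descents\<close>

definition descent :: "step \<Rightarrow> step \<Rightarrow> bool" where
  "descent s t \<longleftrightarrow> (s, t) \<in> {(U, D), (U, L), (L, D)}"

lemma descent_simps [simp]:
  "descent U t \<longleftrightarrow> t \<noteq> U" "descent L t \<longleftrightarrow> t = D" "\<not> descent D t"
  "descent s D \<longleftrightarrow> s \<noteq> D" "descent s L \<longleftrightarrow> s = U" "\<not> descent s U"
  by (cases s; cases t; simp add: descent_def)+

text \<open>The offset \<open>k\<close> is the position assigned to the first step. Adding 1 to
  every descent is then a change of offset, and a concatenation contributes its blocks plus one
  junction.\<close>

fun descents_from :: "nat \<Rightarrow> step list \<Rightarrow> nat set" where
  "descents_from k (s # t # w) =
     (if descent s t then {k} else {}) \<union> descents_from (Suc k) (t # w)"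
| "descents_from k _ = {}"

lemma descents_from_Cons:
  "descents_from k (s # w) =
     (if w \<noteq> [] \<and> descent s (hd w) then {k} else {}) \<union> descents_from (Suc k) w"
  by (cases w) auto

lemma descents_from_append:
  "descents_from k (u @ v) = descents_from k u \<union>
     (if u \<noteq> [] \<and> v \<noteq> [] \<and> descent (last u) (hd v) then {k + length u - 1} else {}) \<union>
     descents_from (k + length u) v"
  by (induction u arbitrary: k) (auto simp: descents_from_Cons)

lemma descents_from_Ls [simp]: "descents_from k (Ls i) = {}"
  by (induction i arbitrary: k) (auto simp: descents_from_Cons)

lemma Suc_image_descents_from: "Suc ` descents_from k w = descents_from (Suc k) w"
  by (induction k w rule: descents_from.induct) auto

lemma descents_from_eq:
  "descents_from k w = {k + i | i. Suc i < length w \<and> descent (w ! i) (w ! Suc i)}"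
proof (induction k w rule: descents_from.induct)
  case (1 k s t w)
  have "(\<exists>i. P i) \<longleftrightarrow> P 0 \<or> (\<exists>i. P (Suc i))" for P
    by (metis not0_implies_Suc)
  from this[of "\<lambda>i. x = k + i \<and> i < Suc (length w) \<and>
      descent ((s # t # w) ! i) ((t # w) ! i)" for x]
  show ?case by (auto simp: 1)
qed auto

lemma Des_hat_eq: "Des_hat w = descents_from 1 w"
proof (intro set_eqI iffI)
  fix x assume "x \<in> Des_hat w"
  then have "x = 1 + (x - 1)" "Suc (x - 1) < length w" "descent (w ! (x - 1)) (w ! Suc (x - 1))"
    by (auto simp: Des_hat_def descent_def)
  then show "x \<in> descents_from 1 w" unfolding descents_from_eq by blast
next
  fix x assume "x \<in> descents_from 1 w"
  then show "x \<in> Des_hat w" by (auto simp: Des_hat_def descents_from_eq descent_def)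
qed

section \<open>The cyclic descent at the last position\<close>

definition wraps :: "step list \<Rightarrow> bool" where
  "wraps M \<longleftrightarrow> step_before_last_return M \<noteq> L \<and> (hd M = L \<or> hd M = U \<and> card (returns M) = 1)"

lemma cDes_hat_eq:
  "cDes_hat M = descents_from 1 M \<union> (if wraps M then {length M} else {})"
  by (auto simp: cDes_hat_def wraps_def Des_hat_eq)

text \<open>Ordinary descents are smaller than \<open>n\<close>, so reduction modulo
  \<open>n\<close> leaves them alone; only the wrapping position \<open>n\<close> is sent to
  1.\<close>

lemma image_rotate_cDes_hat:
  assumes "length M = n"
  shows "(\<lambda>i. i mod n + 1) ` cDes_hat M = descents_from 2 M \<union> (if wraps M then {1} else {})"
proof -
  have "(\<lambda>i. i mod n + 1) ` descents_from 1 M = Suc ` descents_from 1 M"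
    using assms by (intro image_cong) (auto simp: descents_from_eq)
  then show ?thesis
    by (simp add: cDes_hat_eq image_Un assms Suc_image_descents_from numeral_2_eq_2)
qed

text \<open>A nonempty \<open>P\<close> ends in \<open>D\<close> and so has a return of its own,
  which excludes the one-return clause and leaves \<open>hd P = L\<close>. If \<open>P\<close> is
  empty, the first step is \<open>L\<close>, or it is \<open>U\<close> with a single return. Cases 1
  and 3 are both of this form.\<close>

lemma wraps_last_component:
  assumes "motzkin_empty_or_final_D P" "motzkin_path Q" "Q = [] \<or> last Q \<noteq> L"
  shows "wraps (P @ Ls i @ U # Q @ D # Ls j) \<longleftrightarrow> P = [] \<or> hd P = L"
proof -
  let ?M = "P @ Ls i @ U # Q @ D # Ls j"
  have P: "motzkin_path P" "P = [] \<or> last P = D"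
    using assms(1) by (auto simp: motzkin_empty_or_final_D_def)
  have "height (P @ Ls i @ U # Q) = 1"
    using assms(2) P by (simp add: motzkin_path_height)
  from step_before_last_return_eq[OF this, of j]
  have sb: "step_before_last_return ?M \<noteq> L" using assms(3) by auto
  \<comment> \<open>This bracketing makes each left factor a Motzkin path, so that returns can be
    counted factor by factor.\<close>
  have M: "?M = P @ (Ls i @ ((U # Q @ [D]) @ Ls j))" by simp
  have "returns (Ls j) = {}" "returns (Ls i) = {}"
    by (simp_all add: returns_eq_empty_iff)
  then have card: "card (returns ?M) = Suc (card (returns P))"
    unfolding M card_returns_append[OF P(1)] card_returns_append[OF motzkin_path_Ls]
      card_returns_append[OF motzkin_path_lift[OF assms(2)]] returns_lift[OF assms(2)]
    by simp
  have "returns [] = {}" by (simp add: returns_eq_empty_iff)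
  show ?thesis
  proof (cases "P = []")
    case True
    then show ?thesis using sb card \<open>returns [] = {}\<close> by (cases i) (auto simp: wraps_def)
  next
    case False
    then have "D \<in> set P" using P(2) last_in_set by metis
    then have "card (returns P) \<noteq> 0" using returns_eq_empty_iff P(1) by auto
    then show ?thesis using False sb card by (auto simp: wraps_def)
  qed
qed

lemma not_wraps_if_L:
  assumes "height A = 1" "last A = L"
  shows "\<not> wraps (A @ D # Ls j)"
  using step_before_last_return_eq[OF assms(1), of j] assms(2) by (simp add: wraps_def)

lemma not_wraps_if_later_return:
  assumes "motzkin_path Q" "motzkin_path T" "D \<in> set T"
  shows "\<not> wraps (U # Q @ D # T)"
proof -
  have "card (returns ((U # Q @ [D]) @ T)) = 1 + card (returns T)"
    unfolding card_returns_append[OF motzkin_path_lift[OF assms(1)]] returns_lift[OF assms(1)]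
    by simp
  moreover have "card (returns T) \<noteq> 0"
    using returns_eq_empty_iff[OF assms(2)] assms(3) by auto
  ultimately show ?thesis by (simp add: wraps_def)
qed

section \<open>Equivariance\<close>

lemma rho_rel_image:
  assumes "rho_rel M N" "motzkin_path M"
  shows "motzkin_path N \<and> length N = length M \<and> D \<in> set N"
  using assms(1)
proof (cases rule: rho_rel_cases)
  case (1 P i j)
  then have "motzkin_path P" by (simp add: motzkin_empty_or_final_D_def)
  with 1 show ?thesis
    by (auto simp: motzkin_path_iff intro: nonneg_from_mono)
next
  case (2 P i j)
  \<comment> \<open>Here \<open>P\<close> is only an initial segment of \<open>M\<close>, so its
    height and nonnegativity must come from \<open>M\<close>; in the other cases \<open>P\<close> is
    a Motzkin path, raised by the leading \<open>U\<close>.\<close>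
  then show ?thesis using assms(2) by (auto simp: motzkin_path_iff dest: nonneg_from_start)
next
  case (3 P i k R j)
  then have "motzkin_path P" by (simp add: motzkin_empty_or_final_D_def)
  with 3 show ?thesis
    by (auto simp: motzkin_path_iff intro: nonneg_from_mono)
qed

text \<open>At the seam, 1 is a descent of \<open>N\<close> exactly when \<open>M\<close> wraps, and
  \<open>N\<close> wraps exactly when \<open>M\<close> has a descent just before its last step. All
  other junctions agree after the shift by one.\<close>

lemma cDes_hat_rho_rel:
  assumes "rho_rel M N" "motzkin_path M"
  shows "cDes_hat N = (\<lambda>i. i mod length M + 1) ` cDes_hat M"
proof -
  have "cDes_hat N = descents_from 2 M \<union> (if wraps M then {1} else {})"
    using assms(1)
  proof (cases rule: rho_rel_cases)
    case (1 P i j)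
    then have P: "motzkin_path P" "P = [] \<or> last P = D"
      by (auto simp: motzkin_empty_or_final_D_def)
    have hd: "P = [] \<or> hd P = U \<or> hd P = L"
      using motzkin_path_hd[OF P(1)] by (cases "hd P") auto
    have M: "wraps M \<longleftrightarrow> P = [] \<or> hd P = L"
      using wraps_last_component[of P "[]" i j] 1 by simp
    show ?thesis
    proof (cases j)
      case 0
      have "wraps N"
        using 1 0 P wraps_last_component[of "[]" P 0 i] by (auto simp: motzkin_empty_or_final_D_def)
      then show ?thesis using M 1(2,4) 0 P hd
        by (auto simp: cDes_hat_eq numeral_2_eq_2 descents_from_append descents_from_Cons
              hd_append
            split: if_splits)
    next
      case (Suc m)
      have "\<not> wraps N"
        using 1 Suc P not_wraps_if_L[of "U # P @ Ls (Suc i)" m] by (simp add: motzkin_path_height)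
      then show ?thesis using M 1(2,4) Suc P hd
        by (auto simp: cDes_hat_eq numeral_2_eq_2 descents_from_append descents_from_Cons
              hd_append
            split: if_splits)
    qed
  next
    case (2 P i j)
    have h: "height P = 1" using assms(2) 2 by (simp add: motzkin_path_iff)
    have M: "\<not> wraps M"
      using 2 h not_wraps_if_L[of "P @ Ls i" j] by simp
    \<comment> \<open>Hence the new leading \<open>L\<close> creates no descent at position 1, as
      required since \<open>M\<close> does not wrap.\<close>
    have "hd P \<noteq> D"
      using 2 motzkin_path_hd[OF assms(2)] by auto
    \<comment> \<open>The step after \<open>P\<close> may change from \<open>L\<close> to
      \<open>D\<close>. As \<open>P\<close> does not end in \<open>L\<close>, whether there is a
      descent there is unaffected.\<close>
    have last: "last P = U \<or> last P = D"
      using 2(4) by (cases "last P") auto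
    show ?thesis
    proof (cases j)
      case 0
      have "wraps N"
        using 2 0 h step_before_last_return_eq[of "L # P" "i - 1"] by (simp add: wraps_def)
      then show ?thesis using M 2(2-6) 0 \<open>hd P \<noteq> D\<close> last
        by (auto simp: cDes_hat_eq numeral_2_eq_2 descents_from_append descents_from_Cons
              hd_append
            split: if_splits)
    next
      case (Suc m)
      have "\<not> wraps N"
        using 2 Suc h not_wraps_if_L[of "L # P @ Ls i" m] by simp
      then show ?thesis using M 2(2-6) Suc \<open>hd P \<noteq> D\<close> last
        by (auto simp: cDes_hat_eq numeral_2_eq_2 descents_from_append descents_from_Cons
              hd_append
            split: if_splits)
    qed
  next
    case (3 P i k R j)
    then have P: "motzkin_path P" "P = [] \<or> last P = D"
      by (auto simp: motzkin_empty_or_final_D_def)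
    have hd: "P = [] \<or> hd P = U \<or> hd P = L"
      using motzkin_path_hd[OF P(1)] by (cases "hd P") auto
    have "D \<in> set R" using 3 last_in_set by metis
    have M: "wraps M \<longleftrightarrow> P = [] \<or> hd P = L"
      using wraps_last_component[of P "Ls k @ R" i j] 3 by (simp add: motzkin_path_cancel)
    show ?thesis
    proof (cases k)
      case 0
      have "\<not> wraps N"
        using 3 0 P \<open>D \<in> set R\<close> not_wraps_if_later_return[of P "Ls i @ R @ Ls j"]
        by (simp add: motzkin_path_cancel)
      then show ?thesis using M 3(2,6-9) 0 P hd
        by (auto simp: cDes_hat_eq numeral_2_eq_2 descents_from_append descents_from_Cons
              hd_append ac_simps
            split: if_splits)
    next
      case (Suc m)
      have "\<not> wraps N"
        using 3 Suc P \<open>D \<in> set R\<close> not_wraps_if_later_return[of "P @ Ls (Suc i)" "Ls m @ R @ Ls j"]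
        by (simp add: motzkin_path_cancel)
      then show ?thesis using M 3(2,6-9) Suc P hd
        by (auto simp: cDes_hat_eq numeral_2_eq_2 descents_from_append descents_from_Cons
              hd_append ac_simps
            split: if_splits)
    qed
  qed
  then show ?thesis by (simp only: image_rotate_cDes_hat[OF refl])
qed

section \<open>The cyclic extension\<close>

text \<open>A Motzkin path without \<open>D\<close> is flat, so removing the all-\<open>L\<close>
  path means requiring a \<open>D\<close>, the form in which the existence of a return is
  used.\<close>

lemma Motzkin_star_iff: "M \<in> Motzkin_star n \<longleftrightarrow> length M = n \<and> motzkin_path M \<and> D \<in> set M"
proof -
  have "M = Ls n \<longleftrightarrow> D \<notin> set M" if "length M = n" "motzkin_path M"
    using that flat_if_no_D[of M] motzkin_path_height[of M]
    by (metis in_set_replicate order_refl step.distinct(5))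
  then show ?thesis by (auto simp: Motzkin_star_def Motzkin_def)
qed

lemma finite_Motzkin_star: "finite (Motzkin_star n)"
proof -
  have "(UNIV :: step set) = {U, L, D}" using step.exhaust by auto
  then have "finite {w :: step list. set w \<subseteq> UNIV \<and> length w = n}"
    by (intro finite_lists_length_eq) (metis finite.simps)
  then show ?thesis
    by (rule rev_finite_subset) (auto simp: Motzkin_star_def Motzkin_def)
qed

text \<open>The step before the first \<open>D\<close> is \<open>U\<close> or \<open>L\<close>,
  hence gives a descent.\<close>

lemma descents_from_nonempty:
  "w \<noteq> [] \<Longrightarrow> hd w \<noteq> D \<Longrightarrow> D \<in> set w \<Longrightarrow> \<exists>k. k \<in> descents_from m w"
proof (induction m w rule: descents_from.induct)
  case (1 m s t w)
  then show ?case by (cases s; cases t) auto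
next
  case ("2_2" m s)
  then show ?case by (cases s) auto
qed auto

lemma cDes_hat_nonempty:
  assumes "motzkin_path M" "D \<in> set M"
  shows "cDes_hat M \<noteq> {}"
proof -
  have "M \<noteq> []" using assms(2) by auto
  then have "\<exists>k. k \<in> descents_from 1 M"
    using descents_from_nonempty motzkin_path_hd assms by blast
  then show ?thesis by (auto simp: cDes_hat_eq)
qed

text \<open>A descent at every position forces \<open>ULD\<close>, which does not wrap.\<close>

lemma cDes_hat_not_full:
  assumes "motzkin_path M" "length M \<ge> 3"
  shows "cDes_hat M \<noteq> {1..length M}"
proof
  assume full: "cDes_hat M = {1..length M}"
  obtain a b c w where M: "M = a # b # c # w"
    using assms(2) by (metis Suc_le_length_iff numeral_3_eq_3)
  have desc: "descent (M ! i) (M ! Suc i)" if "Suc i < length M" for i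
  proof -
    have "1 + i \<in> cDes_hat M" using full that by simp
    with that show ?thesis
      by (auto simp: cDes_hat_eq descents_from_eq split: if_splits)
  qed
  have abc: "a = U" "b = L" "c = D"
    using desc[of 0] desc[of 1] by (cases a; cases b; cases c; simp add: M)+
  have "w = []"
    using desc[of 2] by (cases w) (auto simp: M abc numeral_2_eq_2)
  then have "\<not> wraps M"
    using not_wraps_if_L[of "[U, L]" 0] by (simp add: M abc)
  moreover have "length M \<in> cDes_hat M" using full assms(2) by auto
  ultimately show False by (auto simp: cDes_hat_eq descents_from_eq)
qed

theorem theorem3p9:
  fixes n :: nat
  assumes "n \<ge> 3"
  shows "cyclic_extension n (Motzkin_star n) Des_hat cDes_hat rho_hat"
proof -
  let ?F = "Motzkin_star n"
  have rel: "rho_rel M (rho_hat M)" if "M \<in> ?F" for M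
    using that rho_rel_total rho_hat_eq by (metis Motzkin_star_iff)
  have "rho_hat ` ?F \<subseteq> ?F"
    using rel rho_rel_image by (fastforce simp: Motzkin_star_iff)
  moreover have inj: "inj_on rho_hat ?F"
    using rel rho_rel_injective by (metis inj_onI)
  ultimately have bij: "bij_betw rho_hat ?F ?F"
    using endo_inj_surj[OF finite_Motzkin_star] by (simp add: bij_betw_def)
  have equiv: "cDes_hat (rho_hat M) = (\<lambda>i. i mod n + 1) ` cDes_hat M" if "M \<in> ?F" for M
    using cDes_hat_rho_rel[OF rel[OF that]] that by (auto simp: Motzkin_star_iff)
  have Des: "Des_hat M \<subseteq> {1..n - 1}" if "M \<in> ?F" for M
    using that by (auto simp: Des_hat_def Motzkin_star_iff)
  have cDes: "cDes_hat M \<subseteq> {1..n}" "cDes_hat M \<inter> {1..n - 1} = Des_hat M" if "M \<in> ?F" for M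
    using Des[OF that] that assms
    by (fastforce simp: cDes_hat_def Motzkin_star_iff split: if_splits)+
  have "{} \<subset> cDes_hat M \<and> cDes_hat M \<subset> {1..n}" if "M \<in> ?F" for M
    using cDes(1)[OF that] cDes_hat_nonempty[of M] cDes_hat_not_full[of M] that assms
    by (auto simp: Motzkin_star_iff)
  with finite_Motzkin_star bij equiv Des cDes show ?thesis
    by (simp add: cyclic_extension_def)
qed

end
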